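(* Let $k \ge 1$ be an integer and let $G$ be a graph on $n \ge 2(k-1) + 2^{2(k-1)} + 1$ vertices. Then $G$ has an induced subgraph $H$ with $2k$ vertices that is a $k$-letter graph on the word \[ w = \ell_1 \, \ell_2 \cdots \ell_k \, \ell_k \cdots \ell_2 \, \ell_1, \] i.e., $H \cong \Gamma_D(w)$ for some decoder $D \subseteq \{\ell_1,\dots,\ell_k\}^2$. Consequently $\ell(G) \le n-k$.
   Context: For a finite alphabet $\Sigma$, a decoder is a set $D \subseteq \Sigma^2$ of ordered pairs. For a word $w = w(1)w(2)\cdots w(n)$ with letters in $\Sigma$, the letter graph $\Gamma_D(w)$ is the graph with vertex set $\{1,\dots,n\}$ and an edge between $i<j$ exactly when $(w(i),w(j)) \in D$. If $|\Sigma| = k$, $\Gamma_D(w)$ is called a $k$-letter graph. The lettericity $\ell(G)$ of a graph $G$ is the least integer $k$ such that $G$ is isomorphic to a $k$-letter graph. *)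

theory Defs
  imports "Graph_Theory.Graph_Theory"
begin

text \<open>
  A finite simple graph is a \<open>pair_graph\<close>: each undirected edge \<open>{u, v}\<close> is
  represented by the two arcs \<open>(u, v)\<close> and \<open>(v, u)\<close>.
\<close>

text \<open>Vertices are the positions \<open>1, \<dots>, n\<close>, so the letter at position \<open>i\<close> is \<open>w ! (i - 1)\<close>.\<close>

definition letter_graph :: "('l \<times> 'l) set \<Rightarrow> 'l list \<Rightarrow> nat pair_pre_digraph" where
  "letter_graph D w =
    (let E = {(i, j). 1 \<le> i \<and> i < j \<and> j \<le> length w \<and> (w ! (i - 1), w ! (j - 1)) \<in> D}
     in \<lparr> pverts = {1..length w}, parcs = E \<union> E\<inverse> \<rparr>)"

lemma pair_graph_letter_graph: "pair_graph (letter_graph D w)"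
proof
  show "finite (parcs (letter_graph D w))"
    by (rule finite_subset[of _ "{1..length w} \<times> {1..length w}"])
       (auto simp: letter_graph_def Let_def)
qed (auto simp: letter_graph_def Let_def symmetric_def intro!: symI)

text \<open>
  Only the cardinality of the alphabet matters, so alphabets may be taken to be sets of
  natural numbers. The word need not use every letter of the alphabet.
\<close>

definition k_letter_graph :: "nat \<Rightarrow> nat pair_pre_digraph \<Rightarrow> bool" where
  "k_letter_graph k H \<longleftrightarrow>
    (\<exists>(\<Sigma> :: nat set) D w. finite \<Sigma> \<and> card \<Sigma> = k \<and> D \<subseteq> \<Sigma> \<times> \<Sigma> \<and> w \<in> lists \<Sigma> \<and>
       H = letter_graph D w)"

definition lettericity :: "'a pair_pre_digraph \<Rightarrow> nat" where
  "lettericity G = (LEAST k. \<exists>H. k_letter_graph k H \<and> digraph_iso (with_proj G) (with_proj H))"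

text \<open>
  On graphs given by pairs, the library's isomorphism is the usual one: a bijection of the
  vertices that preserves and reflects adjacency.
\<close>

lemma digraph_iso_pair_iff:
  fixes G :: "'a pair_pre_digraph" and H :: "'b pair_pre_digraph"
  assumes "pair_graph G" "pair_graph H"
  shows "digraph_iso G H \<longleftrightarrow>
    (\<exists>f. bij_betw f (pverts G) (pverts H) \<and>
      (\<forall>u\<in>pverts G. \<forall>v\<in>pverts G. (u, v) \<in> parcs G \<longleftrightarrow> (f u, f v) \<in> parcs H))"
proof
  interpret G: pair_graph G by fact
  assume "digraph_iso G H"
  then obtain h where h: "G.digraph_isomorphism h" and H: "with_proj H = app_iso h G"
    by (auto simp: digraph_iso_def)
  have tl: "iso_tail h = fst" "iso_head h = snd"
    using H by (simp_all add: with_proj_def app_iso_def)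
  have V: "pverts H = iso_verts h ` pverts G" and A: "parcs H = iso_arcs h ` parcs G"
    using H by (simp_all add: with_proj_def app_iso_def)
  have inj: "inj_on (iso_verts h) (pverts G)"
    using h by (simp add: G.digraph_isomorphism_def)
  have arc: "iso_arcs h (u, v) = (iso_verts h u, iso_verts h v)" if "(u, v) \<in> parcs G" for u v
    using h that by (auto simp: G.digraph_isomorphism_def tl prod_eq_iff)
  have "(u, v) \<in> parcs G \<longleftrightarrow> (iso_verts h u, iso_verts h v) \<in> parcs H"
    if uv: "u \<in> pverts G" "v \<in> pverts G" for u v
  proof
    assume "(u, v) \<in> parcs G"
    then show "(iso_verts h u, iso_verts h v) \<in> parcs H"
      unfolding A using arc by (metis image_eqI)
  next
    assume "(iso_verts h u, iso_verts h v) \<in> parcs H"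
    then obtain x y where xy: "(x, y) \<in> parcs G"
      and eq: "(iso_verts h u, iso_verts h v) = iso_arcs h (x, y)"
      unfolding A by auto
    have "x \<in> pverts G" "y \<in> pverts G"
      using xy G.in_arcsD1 G.in_arcsD2 by blast+
    then have "u = x" "v = y"
      using eq arc[OF xy] inj uv by (auto dest: inj_onD)
    then show "(u, v) \<in> parcs G" using xy by simp
  qed
  then show "\<exists>f. bij_betw f (pverts G) (pverts H) \<and>
      (\<forall>u\<in>pverts G. \<forall>v\<in>pverts G. (u, v) \<in> parcs G \<longleftrightarrow> (f u, f v) \<in> parcs H)"
    using inj V by (auto simp: bij_betw_def)
next
  interpret G: pair_graph G by fact
  interpret H: pair_graph H by fact
  assume "\<exists>f. bij_betw f (pverts G) (pverts H) \<and>
      (\<forall>u\<in>pverts G. \<forall>v\<in>pverts G. (u, v) \<in> parcs G \<longleftrightarrow> (f u, f v) \<in> parcs H)"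
  then obtain f where inj: "inj_on f (pverts G)" and V: "pverts H = f ` pverts G"
    and adj: "\<And>u v. u \<in> pverts G \<Longrightarrow> v \<in> pverts G \<Longrightarrow>
      (u, v) \<in> parcs G \<longleftrightarrow> (f u, f v) \<in> parcs H"
    by (auto simp: bij_betw_def)
  define h where "h = \<lparr> iso_verts = f, iso_arcs = map_prod f f, iso_head = snd, iso_tail = fst \<rparr>"
  have sub: "parcs G \<subseteq> pverts G \<times> pverts G"
    using G.in_arcsD1 G.in_arcsD2 by auto
  have "inj_on (map_prod f f) (parcs G)"
    using inj_on_subset[OF map_prod_inj_on[OF inj inj] sub] .
  then have "G.digraph_isomorphism h"
    using inj G.wf_digraph by (auto simp: G.digraph_isomorphism_def h_def)
  moreover have "parcs H = map_prod f f ` parcs G"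
  proof (intro equalityI subsetI)
    fix e assume "e \<in> parcs H"
    then obtain x y where e: "e = (x, y)" "(x, y) \<in> parcs H" by (cases e) auto
    moreover have "x \<in> pverts H" "y \<in> pverts H"
      using e(2) H.in_arcsD1 H.in_arcsD2 by blast+
    ultimately obtain u v where "u \<in> pverts G" "v \<in> pverts G" "x = f u" "y = f v"
      using V by auto
    then show "e \<in> map_prod f f ` parcs G" using e adj by force
  next
    fix e assume "e \<in> map_prod f f ` parcs G"
    then show "e \<in> parcs H" using adj sub by auto
  qed
  then have "with_proj H = app_iso h G"
    using V by (simp add: with_proj_def app_iso_def h_def)
  ultimately show "digraph_iso G H"
    by (auto simp: digraph_iso_def)
qed

end

theory Submission
  imports Defs
begin

text \<open>
  On the word \<open>\<ell>\<^sub>1 \<dots> \<ell>\<^sub>k \<ell>\<^sub>k \<dots> \<ell>\<^sub>1\<close> let \<open>a\<^sub>i\<close> and \<open>b\<^sub>i\<close> be the vertices carrying the first and the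
  second occurrence of \<open>\<ell>\<^sub>i\<close>. A graph on these vertices is a letter graph of the word iff, for
  \<open>i < j\<close>, neither \<open>a\<^sub>i\<close> nor \<open>b\<^sub>i\<close> distinguishes \<open>a\<^sub>j\<close> from \<open>b\<^sub>j\<close>. Such pairs can be chosen greedily:
  at most \<open>2 ^ (2 * j)\<close> neighbourhoods are possible in the \<open>2 * j\<close> vertices already chosen, so two
  of the remaining vertices agree there. The other vertices of the graph get private letters in
  the middle of the word; there such a vertex follows \<open>a\<^sub>i\<close> and precedes \<open>b\<^sub>i\<close>, so that its
  adjacencies to both are encoded independently.
\<close>

text \<open>Nothing relates \<open>as ! i\<close> to \<open>bs ! i\<close>: the letter pair
  (\<open>\<ell>\<^sub>i\<close>, \<open>\<ell>\<^sub>i\<close>) arises at a single pair of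
  positions of the word, so the decoder can settle it freely.\<close>

definition nested_twins :: "('a \<times> 'a) set \<Rightarrow> 'a list \<Rightarrow> 'a list \<Rightarrow> bool" where
  "nested_twins A as bs \<longleftrightarrow> length as = length bs \<and>
    (\<forall>j < length as. \<forall>i < j.
      ((as ! i, as ! j) \<in> A \<longleftrightarrow> (as ! i, bs ! j) \<in> A) \<and>
      ((bs ! i, as ! j) \<in> A \<longleftrightarrow> (bs ! i, bs ! j) \<in> A))"

lemma nested_twins_snoc:
  assumes "nested_twins A as bs"
    and "\<And>s. s \<in> set as \<union> set bs \<Longrightarrow> (s, x) \<in> A \<longleftrightarrow> (s, y) \<in> A"
  shows "nested_twins A (as @ [x]) (bs @ [y])"
  using assms unfolding nested_twins_def by (auto simp: nth_append less_Suc_eq)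

text \<open>Carries the pairs found in the whole graph over to the subgraph induced on them.\<close>

lemma nested_twins_restrict:
  assumes "nested_twins A as bs" and "set as \<union> set bs \<subseteq> S"
  shows "nested_twins (A \<inter> S \<times> S) as bs"
proof -
  have "as ! i \<in> S" "bs ! i \<in> S" if "i < length as" for i
    using that assms by (auto simp: nested_twins_def)
  then show ?thesis using assms(1) by (auto simp: nested_twins_def)
qed

lemma exists_nested_twins:
  assumes "finite V" and "2 * (k - 1) + 2 ^ (2 * (k - 1)) + 1 \<le> card V"
  shows "\<exists>as bs. length as = k \<and> distinct (as @ bs) \<and> set (as @ bs) \<subseteq> V \<and> nested_twins A as bs"
  using assms(2)
proof (induction k)
  case 0
  show ?case by (intro exI[of _ "[]"]) (simp add: nested_twins_def)
next
  case (Suc k)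
  \<comment> \<open>The required size grows with \<open>k\<close>, so the induction hypothesis
    applies to the same \<open>V\<close>. Truncated subtraction gives \<open>k = 0\<close> the same
    bound as \<open>k = 1\<close>.\<close>
  have "(2::nat) ^ (2 * (k - 1)) \<le> 2 ^ (2 * k)"
    by (rule power_increasing) auto
  then have "2 * (k - 1) + 2 ^ (2 * (k - 1)) + 1 \<le> card V"
    using Suc.prems unfolding diff_Suc_1 by linarith
  then obtain as bs where len: "length as = k" and dist: "distinct (as @ bs)"
    and V: "set (as @ bs) \<subseteq> V" and twins: "nested_twins A as bs"
    using Suc.IH by blast
  define S where "S = set (as @ bs)"
  have len_bs: "length bs = k"
    using twins len by (simp add: nested_twins_def)
  have card_S: "card S = 2 * k"
    unfolding S_def using distinct_card[OF dist] len len_bs by simp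
  have fin: "finite S" by (simp add: S_def)
  have "card (V - S) = card V - 2 * k"
    using card_Diff_subset[OF fin] V card_S by (simp add: S_def)
  \<comment> \<open>The bound for \<open>Suc k\<close> is \<open>2 * k + 2 ^ (2 * k) + 1\<close>:
    outside the \<open>2 * k\<close> chosen vertices there remains at least one vertex more than
    \<open>S\<close> has subsets.\<close>
  then have "card (Pow S) < card (V - S)"
    using Suc.prems card_S fin by (simp add: card_Pow)
  moreover define N where "N x = {s \<in> S. (s, x) \<in> A}" for x
  moreover have "card (N ` (V - S)) \<le> card (Pow S)"
    using fin by (intro card_mono) (auto simp: N_def)
  ultimately have "\<not> inj_on N (V - S)"
    by (intro pigeonhole) simp
  then obtain x y where xy: "x \<in> V - S" "y \<in> V - S" "x \<noteq> y" "N x = N y"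
    by (auto simp: inj_on_def)
  have "(s, x) \<in> A \<longleftrightarrow> (s, y) \<in> A" if "s \<in> set as \<union> set bs" for s
    using xy(4) that by (auto simp: N_def S_def)
  then have "nested_twins A (as @ [x]) (bs @ [y])"
    using nested_twins_snoc[OF twins] by blast
  moreover have "length (as @ [x]) = Suc k" "distinct ((as @ [x]) @ bs @ [y])"
    "set ((as @ [x]) @ bs @ [y]) \<subseteq> V"
    using len dist V xy by (auto simp: S_def)
  ultimately show ?case by blast
qed

text \<open>If adjacency depends only on the ordered pair of letters, a decoder can be read off from
  \<open>G\<close>. One implication in \<open>det\<close> suffices, since the two pairs of positions
  can be exchanged.\<close>

lemma digraph_iso_letter_graph:
  fixes G :: "'a pair_pre_digraph"
  assumes G: "pair_graph G" and dist: "distinct vs" and set: "set vs = pverts G"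
    and len: "length w = length vs"
    and det: "\<And>i j i' j'. \<lbrakk>i < j; j < length vs; i' < j'; j' < length vs; w ! i = w ! i'; w ! j = w ! j';
        (vs ! i, vs ! j) \<in> parcs G\<rbrakk> \<Longrightarrow> (vs ! i', vs ! j') \<in> parcs G"
  shows "\<exists>D \<subseteq> set w \<times> set w. digraph_iso (with_proj G) (with_proj (letter_graph D w))"
proof -
  interpret G: pair_graph G by fact
  define D where "D = {(w ! i, w ! j) |i j. i < j \<and> j < length vs \<and> (vs ! i, vs ! j) \<in> parcs G}"
  define N where "N = length vs"
  \<comment> \<open>Vertices of a letter graph are numbered from 1, list entries from 0.\<close>
  define p where "p i = vs ! (i - 1)" for i
  define f where "f = inv_into {1..N} p"
  have D: "(w ! i, w ! j) \<in> D \<longleftrightarrow> (vs ! i, vs ! j) \<in> parcs G" if "i < j" "j < N" for i j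
  proof
    assume "(w ! i, w ! j) \<in> D"
    then obtain i' j' where "i' < j'" "j' < length vs" "w ! i' = w ! i" "w ! j' = w ! j"
      "(vs ! i', vs ! j') \<in> parcs G"
      unfolding D_def by auto
    then show "(vs ! i, vs ! j) \<in> parcs G"
      using det[of i' j' i j] that by (simp add: N_def)
  qed (use that in \<open>auto simp: D_def N_def\<close>)
  have sym: "(u, v) \<in> parcs G \<longleftrightarrow> (v, u) \<in> parcs G" for u v
    using G.arcs_symmetric by blast
  have "bij_betw (\<lambda>i. i - 1) {1..N} {..<N}"
    by (rule bij_betwI[where g = Suc]) auto
  then have p: "bij_betw p {1..N} (pverts G)"
    using bij_betw_trans[OF _ bij_betw_nth[OF dist refl refl]]
    by (simp add: p_def[abs_def] comp_def N_def set)
  have f: "bij_betw f (pverts G) {1..N}"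
    unfolding f_def by (rule bij_betw_inv_into[OF p])
  have arc: "(p i, p j) \<in> parcs G \<longleftrightarrow> (i, j) \<in> parcs (letter_graph D w)"
    if "i \<in> {1..N}" "j \<in> {1..N}" for i j
  proof (cases i j rule: linorder_cases)
    case less
    then show ?thesis
      using that D[of "i - 1" "j - 1"] len by (auto simp: letter_graph_def Let_def p_def N_def)
  next
    case equal
    then show ?thesis by (auto simp: letter_graph_def Let_def dest: G.no_loops)
  next
    case greater
    then show ?thesis
      using that D[of "j - 1" "i - 1"] len sym by (auto simp: letter_graph_def Let_def p_def N_def)
  qed
  have "(u, v) \<in> parcs G \<longleftrightarrow> (f u, f v) \<in> parcs (letter_graph D w)"
    if "u \<in> pverts G" "v \<in> pverts G" for u v
    using arc[of "f u" "f v"] that f bij_betw_inv_into_right[OF p] bij_betwE[OF f]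
    by (simp add: f_def)
  moreover have "pverts (letter_graph D w) = {1..N}"
    using len by (simp add: letter_graph_def Let_def N_def)
  ultimately have "digraph_iso (with_proj G) (with_proj (letter_graph D w))"
    unfolding digraph_iso_pair_iff[OF G pair_graph_letter_graph]
    using f by (intro exI[of _ f]) simp
  moreover have "D \<subseteq> set w \<times> set w"
    using len by (auto simp: D_def)
  ultimately show ?thesis by blast
qed

text \<open>With \<open>ms\<close> empty this yields the induced subgraph on the pairs; with
  \<open>ms\<close> listing all other vertices it encodes the whole graph.\<close>

lemma nested_twins_digraph_iso_letter_graph:
  fixes G :: "'a pair_pre_digraph"
  assumes G: "pair_graph G" and dist: "distinct (as @ ms @ bs)"
    and set: "set (as @ ms @ bs) = pverts G"
    and twins: "nested_twins (parcs G) as bs"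
    and word: "distinct (ws @ us)" "length ws = length as" "length us = length ms"
  shows "\<exists>D \<subseteq> set (ws @ us) \<times> set (ws @ us).
    digraph_iso (with_proj G) (with_proj (letter_graph D (ws @ us @ rev ws)))"
proof -
  interpret G: pair_graph G by fact
  define k where "k = length as"
  define m where "m = length ms"
  define N where "N = k + m + k"
  define vs where "vs = as @ ms @ rev bs"
  define w where "w = ws @ us @ rev ws"
  \<comment> \<open>\<open>c i\<close> locates the letter at position \<open>i\<close> within
    \<open>ws @ us\<close>; the final block is the mirror image of the first one under
    \<open>N - 1 - i\<close>.\<close>
  define c where "c i = (if i < k + m then i else N - 1 - i)" for i
  have len: "length bs = k" "length ws = k" "length us = m" "length vs = N" "length w = N"
    using twins word by (simp_all add: nested_twins_def vs_def w_def N_def k_def m_def)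
  have w_nth: "w ! i = (ws @ us) ! c i" if "i < N" for i
    using that len by (auto simp: w_def c_def nth_append rev_nth N_def ac_simps)
  have pos: "i = i' \<or> i < k \<and> i' = N - 1 - i \<or> i' < k \<and> i = N - 1 - i'"
    if "i < N" "i' < N" "w ! i = w ! i'" for i i'
  proof -
    have "c i < length (ws @ us)" "c i' < length (ws @ us)"
      using that len by (auto simp: c_def N_def)
    then have "c i = c i'"
      using that w_nth nth_eq_iff_index_eq[OF word(1)] by metis
    then show ?thesis
      using that by (auto simp: c_def N_def split: if_splits)
  qed
  have vs_a: "vs ! i = as ! i" if "i < k" for i
    using that by (simp add: vs_def nth_append k_def)
  have vs_b: "vs ! (N - 1 - i) = bs ! i" if "i < k" for i
    using that len by (auto simp: vs_def nth_append rev_nth N_def k_def m_def)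
  have sym: "(u, v) \<in> parcs G \<longleftrightarrow> (v, u) \<in> parcs G" for u v
    using G.arcs_symmetric by blast
  \<comment> \<open>Mirroring the later position replaces \<open>as ! j\<close> by
    \<open>bs ! j\<close>, which \<open>as ! i\<close> does not distinguish.\<close>
  have late: "(vs ! i, vs ! j) \<in> parcs G \<longleftrightarrow> (vs ! i, vs ! (N - 1 - j)) \<in> parcs G"
    if "i < j" "j < k" for i j
    using that twins vs_a vs_b by (auto simp: nested_twins_def k_def)
  \<comment> \<open>Here \<open>j\<close> lies beyond both occurrences of the letter at
    \<open>i\<close>, so it carries \<open>bs ! t\<close> with \<open>t < i\<close>. This vertex
    does not distinguish \<open>as ! i\<close> from \<open>bs ! i\<close>; symmetry is used because
    \<open>nested_twins\<close> puts the vertex of smaller index first.\<close>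
  have early: "(vs ! i, vs ! j) \<in> parcs G \<longleftrightarrow> (vs ! (N - 1 - i), vs ! j) \<in> parcs G"
    if "N - 1 - i < j" "i < k" "j < N" for i j
  proof -
    define t where "t = N - 1 - j"
    have t: "t < i" "j = N - 1 - t" using that by (auto simp: t_def)
    show ?thesis
      using that t twins vs_a vs_b sym by (auto simp: nested_twins_def k_def)
  qed
  have det: "(vs ! i, vs ! j) \<in> parcs G \<longleftrightarrow> (vs ! i', vs ! j') \<in> parcs G"
    if "i < j" "j < N" "i' < j'" "j' < N" "w ! i = w ! i'" "w ! j = w ! j'" for i j i' j'
  proof -
    have i: "i = i' \<or> i < k \<and> i' = N - 1 - i \<or> i' < k \<and> i = N - 1 - i'"
      using that by (intro pos) auto
    have j: "j = j' \<or> j < k \<and> j' = N - 1 - j \<or> j' < k \<and> j = N - 1 - j'"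
      using that by (intro pos) auto
    \<comment> \<open>Mirroring both positions would reverse their order, so at most one of the two
      differs between the pairs.\<close>
    have "\<not> (i < k \<and> i' = N - 1 - i \<and> (j < k \<and> j' = N - 1 - j \<or> j' < k))"
      "\<not> (i' < k \<and> i = N - 1 - i' \<and> (j' < k \<and> j = N - 1 - j' \<or> j < k))"
      using that(1-4) by (auto simp: N_def)
    then consider "i = i'" "j = j'"
      | "i = i'" "j < k" "j' = N - 1 - j" | "i = i'" "j' < k" "j = N - 1 - j'"
      | "j = j'" "i < k" "i' = N - 1 - i" | "j = j'" "i' < k" "i = N - 1 - i'"
      using i j by blast
    then show ?thesis
    proof cases
      case 1
      then show ?thesis by simp
    next
      case 2
      then show ?thesis using late[of i j] that(1) by simp
    next
      case 3
      then show ?thesis using late[of i j'] that(3) by simp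
    next
      case 4
      then show ?thesis using early[of i j] that(3,4) by simp
    next
      case 5
      then show ?thesis using early[of i' j'] that(1,2) by simp
    qed
  qed
  have "distinct vs" "set vs = pverts G"
    using dist set by (auto simp: vs_def)
  then have "\<exists>D \<subseteq> set w \<times> set w. digraph_iso (with_proj G) (with_proj (letter_graph D w))"
  proof (rule digraph_iso_letter_graph[OF G])
    fix i j i' j'
    assume "i < j" "j < length vs" "i' < j'" "j' < length vs" "w ! i = w ! i'" "w ! j = w ! j'"
      "(vs ! i, vs ! j) \<in> parcs G"
    then show "(vs ! i', vs ! j') \<in> parcs G"
      using det[of i j i' j'] len by simp
  qed (simp add: len)
  then show ?thesis by (auto simp: w_def)
qed

lemma lettericity_le:
  assumes "k_letter_graph k H" and "digraph_iso (with_proj G) (with_proj H)"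
  shows "lettericity G \<le> k"
  unfolding lettericity_def using assms by (intro Least_le) blast

theorem theorem3:
  fixes k n :: nat and G :: "'a pair_pre_digraph" and l :: "nat \<Rightarrow> 'l"
  assumes "k \<ge> 1"
    and "pair_graph G"
    and "card (pverts G) = n"
    and "n \<ge> 2 * (k - 1) + 2 ^ (2 * (k - 1)) + 1"
    and "inj_on l {1..k}"
  shows "(\<exists>(H :: 'a pair_pre_digraph) D.
            induced_subgraph (with_proj H) (with_proj G) \<and> card (pverts H) = 2 * k \<and>
            D \<subseteq> l ` {1..k} \<times> l ` {1..k} \<and>
            digraph_iso (with_proj H)
              (with_proj (letter_graph D (map l [1..<k+1] @ rev (map l [1..<k+1])))))
         \<and> lettericity G \<le> n - k"
proof -
  interpret G: pair_graph G by fact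
  obtain as bs where len: "length as = k" and dist: "distinct (as @ bs)"
    and V: "set (as @ bs) \<subseteq> pverts G" and twins: "nested_twins (parcs G) as bs"
    using exists_nested_twins[OF G.finite_verts, of k "parcs G"] assms(3,4) by auto
  have len_bs: "length bs = k"
    using twins len by (simp add: nested_twins_def)
  define S where "S = set (as @ bs)"
  have card_S: "card S = 2 * k"
    unfolding S_def using distinct_card[OF dist] len len_bs by simp
  define H where "H = \<lparr> pverts = S, parcs = parcs G \<inter> S \<times> S \<rparr>"
  have H: "pair_graph H"
  proof
    show "finite (pverts H)" "finite (parcs H)"
      by (auto simp: H_def S_def)
    show "symmetric (with_proj H)"
      using G.arcs_symmetric by (auto simp: H_def symmetric_def intro!: symI)
  qed (auto simp: H_def dest: G.no_loops)
  interpret H: pair_graph H by fact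
  have ind: "induced_subgraph (with_proj H) (with_proj G)"
    using V G.wf_digraph H.wf_digraph
    by (auto simp: induced_subgraph_def subgraph_def compatible_def H_def S_def)
  have "set [1..<k+1] = {1..k}" by auto
  then have "set (map l [1..<k+1]) = l ` {1..k}" "distinct (map l [1..<k+1])"
    using assms(5) by (simp_all only: distinct_map set_map distinct_upt)
  moreover have "nested_twins (parcs H) as bs"
    using nested_twins_restrict[OF twins, of S] by (simp add: H_def S_def)
  ultimately have "\<exists>D \<subseteq> l ` {1..k} \<times> l ` {1..k}. digraph_iso (with_proj H)
      (with_proj (letter_graph D (map l [1..<k+1] @ rev (map l [1..<k+1]))))"
    using nested_twins_digraph_iso_letter_graph[OF H, of as "[]" bs "map l [1..<k+1]" "[]"] dist len
    by (simp add: H_def S_def)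
  moreover have "card (pverts H) = 2 * k"
    by (simp add: H_def card_S)
  moreover have "lettericity G \<le> n - k"
  proof -
    obtain ms where ms: "set ms = pverts G - S" "distinct ms"
      using finite_distinct_list[of "pverts G - S"] by auto
    have "length ms = n - 2 * k"
      using distinct_card[OF ms(2)] ms(1) card_Diff_subset[of S "pverts G"] V assms(3) card_S
      by (simp add: S_def)
    \<comment> \<open>This keeps the subtraction \<open>n - 2 * k\<close> from truncating.\<close>
    moreover have "2 * k \<le> n"
      using card_mono[of "pverts G" S] V assms(3) card_S by (simp add: S_def)
    ultimately have m: "k + length ms = n - k" by simp
    \<comment> \<open>The \<open>k\<close> pairs share the letters below \<open>k\<close>, and each
      of the \<open>n - 2 * k\<close> other vertices gets a letter of its own: \<open>n - k\<close>
      letters in all.\<close>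
    let ?us = "[k..<k + length ms]"
    let ?w = "[0..<k] @ ?us @ rev [0..<k]"
    have all: "set (as @ ms @ bs) = pverts G" "distinct (as @ ms @ bs)"
      using ms V dist by (auto simp: S_def)
    have "set ([0..<k] @ ?us) = {0..<n - k}" using m by auto
    then obtain D where D: "D \<subseteq> {0..<n - k} \<times> {0..<n - k}"
      and iso: "digraph_iso (with_proj G) (with_proj (letter_graph D ?w))"
      using nested_twins_digraph_iso_letter_graph
        [OF assms(2) all(2,1) twins, of "[0..<k]" ?us] len by auto
    have "?w \<in> lists {0..<n - k}" using m by auto
    then have "k_letter_graph (n - k) (letter_graph D ?w)"
      unfolding k_letter_graph_def using D
      by (intro exI[of _ "{0..<n - k}"] exI[of _ D] exI[of _ ?w]) simp
    then show ?thesis using iso by (rule lettericity_le)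
  qed
  ultimately show ?thesis using ind by blast
qed

end
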